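(* Let $\mathbf H_{ii}\in\mathbb C^{N_{\mathrm r}\times N_{\mathrm t}}$ be the self-interference channel, $\mathbf F_{\mathrm{RF}}\in\mathbb C^{N_{\mathrm t}\times L_{\mathrm t}}$ the analog precoder and $\mathbf W_{\mathrm{RF}}\in\mathbb C^{N_{\mathrm r}\times L_{\mathrm r}}$ the analog combiner of a full-duplex device transmitting $N_{\mathrm s}\ge 1$ streams, and let $\eta_{\mathrm{ADC}}\ge 0$. If $$\eta_{\mathrm{ADC}}\ \ge\ \frac1{N_{\mathrm s}}\,\sigma_{\max}^2(\mathbf W_{\mathrm{RF}}^{*}\mathbf H_{ii}\mathbf F_{\mathrm{RF}}),$$ then the per-RF-chain constraint is implied by the precoding power constraint: every digital precoder $\mathbf F_{\mathrm{BB}}\in\mathbb C^{L_{\mathrm t}\times N_{\mathrm s}}$ with $\|\mathbf F_{\mathrm{BB}}\|_{\mathrm F}^2\le 1$ satisfies $$\frac1{N_{\mathrm s}}\,\sigma_{\max}^2(\mathbf W_{\mathrm{RF}}^{*}\mathbf H_{ii}\mathbf F_{\mathrm{RF}}\mathbf F_{\mathrm{BB}})\le\eta_{\mathrm{ADC}}.$$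
   Context: $\mathbf A^{*}$ denotes conjugate transpose, $\|\cdot\|_{\mathrm F}$ the Frobenius norm and $\sigma_{\max}(\mathbf A)$ the largest singular value of $\mathbf A$. The precoding power constraint is $\|\mathbf F_{\mathrm{BB}}\|_{\mathrm F}^2\le 1$. The per-RF-chain (ADC) self-interference power constraint is $\frac1{N_{\mathrm s}}\sigma_{\max}^2(\mathbf W_{\mathrm{RF}}^{*}\mathbf H_{ii}\mathbf F_{\mathrm{RF}}\mathbf F_{\mathrm{BB}})\le\eta_{\mathrm{ADC}}$, where $\eta_{\mathrm{ADC}}$ is a unitless threshold. The matrix dimensions $N_{\mathrm t},N_{\mathrm r},L_{\mathrm t},L_{\mathrm r}$ (numbers of transmit antennas, receive antennas, transmit RF chains, receive RF chains) are positive integers. *)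

theory Defs
  imports
    "Jordan_Normal_Form.Schur_Decomposition"
    "Jordan_Normal_Form.Spectral_Radius"
begin

definition frobenius_norm :: "complex mat \<Rightarrow> real" where
  "frobenius_norm A = sqrt (\<Sum>i<dim_row A. \<Sum>j<dim_col A. (cmod (A $$ (i, j)))\<^sup>2)"

text \<open>
  The singular values are the nonnegative square roots of the eigenvalues of \<open>A\<^sup>* A\<close>.
  For a matrix with more columns than rows this set contains 0 even if the convention that
  lists only \<open>min (dim_row A) (dim_col A)\<close> singular values does not; the largest one is the
  same for both conventions as soon as \<open>A\<close> has a row and a column.
\<close>

definition singular_values :: "complex mat \<Rightarrow> real set" where
  "singular_values A =
     {s. 0 \<le> s \<and> eigenvalue (mat_adjoint A * A) (complex_of_real (s\<^sup>2))}"

definition sigma_max :: "complex mat \<Rightarrow> real" where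
  "sigma_max A = Max (singular_values A)"

lemma mat_adjoint_dim [simp]:
  "dim_row (mat_adjoint A) = dim_col A" "dim_col (mat_adjoint A) = dim_row A"
  by (simp_all add: mat_adjoint_def)

lemma mat_adjoint_index [simp]:
  "i < dim_col A \<Longrightarrow> j < dim_row A \<Longrightarrow> mat_adjoint A $$ (i, j) = conjugate (A $$ (j, i))"
  by (simp add: mat_adjoint_def mat_of_rows_def)

text \<open>For matrices with at least one column, the maximum in \<^const>\<open>sigma_max\<close> is taken over
  a finite nonempty set.\<close>

lemma gram_carrier: "mat_adjoint A * A \<in> carrier_mat (dim_col A) (dim_col A)"
  by (intro carrier_matI) simp_all

lemma finite_singular_values: "finite (singular_values A)"
proof (rule finite_imageD)
  show "finite ((\<lambda>s. complex_of_real (s\<^sup>2)) ` singular_values A)"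
    by (rule finite_subset[OF _ card_finite_spectrum(1)[OF gram_carrier[of A]]])
      (auto simp: singular_values_def spectrum_def)
  show "inj_on (\<lambda>s. complex_of_real (s\<^sup>2)) (singular_values A)"
  proof (rule inj_onI)
    fix s t
    assume "s \<in> singular_values A" "t \<in> singular_values A"
      and "complex_of_real (s\<^sup>2) = complex_of_real (t\<^sup>2)"
    then have "0 \<le> s" "0 \<le> t" "s\<^sup>2 = t\<^sup>2"
      unfolding singular_values_def of_real_eq_iff by auto
    then show "s = t"
      by simp
  qed
qed

lemma singular_values_nonempty:
  assumes "0 < dim_col A"
  shows "singular_values A \<noteq> {}"
proof -
  let ?G = "mat_adjoint A * A" and ?n = "dim_col A"
  obtain k where "eigenvalue ?G k"
    using spectrum_non_empty[OF gram_carrier[of A]] assms by (auto simp: spectrum_def)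
  then obtain v where v: "v \<in> carrier_vec ?n" "v \<noteq> 0\<^sub>v ?n" and Gv: "?G *\<^sub>v v = k \<cdot>\<^sub>v v"
    by (auto simp: eigenvalue_def eigenvector_def)
  define w where "w = A *\<^sub>v v"
  have Av: "w \<in> carrier_vec (dim_row A)"
    unfolding w_def by (intro carrier_vecI) simp
  have "k * (v \<bullet>c v) = (?G *\<^sub>v v) \<bullet>c v"
    using v by (simp add: Gv)
  also have "?G *\<^sub>v v = mat_adjoint A *\<^sub>v w"
    unfolding w_def
    by (rule assoc_mult_mat_vec[of _ ?n "dim_row A" _ ?n]) (use v in auto)
  also have "\<dots> \<bullet>c v
      = (\<Sum>i<?n. (\<Sum>j<dim_row A. cnj (A $$ (j, i)) * w $ j) * cnj (v $ i))"
    using v Av by (simp add: scalar_prod_def lessThan_atLeast0)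
  also have "\<dots> = (\<Sum>j<dim_row A. w $ j * cnj (\<Sum>i<?n. A $$ (j, i) * v $ i))"
    unfolding sum_distrib_right sum_distrib_left cnj_sum
    by (subst sum.swap) (simp add: mult_ac)
  also have "\<dots> = (\<Sum>j<dim_row A. w $ j * cnj (w $ j))"
    using v by (intro sum.cong refl) (simp add: w_def scalar_prod_def lessThan_atLeast0)
  also have "\<dots> = w \<bullet>c w"
    using Av by (simp add: scalar_prod_def lessThan_atLeast0)
  finally have eq: "k * (v \<bullet>c v) = w \<bullet>c w" .
  have vv: "v \<bullet>c v > 0"
    using v by (simp add: conjugate_square_greater_0_vec)
  have ww: "w \<bullet>c w \<ge> 0"
    by (rule conjugate_square_ge_0_vec)
  have k: "k = (w \<bullet>c w) / (v \<bullet>c v)"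
    using eq vv by (auto simp: field_simps)
  have real: "v \<bullet>c v = complex_of_real (Re (v \<bullet>c v))" "w \<bullet>c w = complex_of_real (Re (w \<bullet>c w))"
    using vv ww by (auto simp: less_complex_def less_eq_complex_def complex_eq_iff)
  define r where "r = Re (w \<bullet>c w) / Re (v \<bullet>c v)"
  have "k = complex_of_real r"
    unfolding k r_def of_real_divide real[symmetric] ..
  moreover have "0 \<le> r"
    using vv ww by (auto simp: r_def less_complex_def less_eq_complex_def)
  ultimately have "sqrt r \<in> singular_values A"
    using \<open>eigenvalue ?G k\<close> by (simp add: singular_values_def flip: of_real_power)
  then show ?thesis
    by blast
qed

end

theory Submission
  imports Defs "HOL-Analysis.Convex"
begin

text \<open>
  The point is that \<open>\<parallel>A v\<parallel> \<le> \<sigma> \<parallel>v\<parallel>\<close> for the largest singular value \<open>\<sigma>\<close> of \<open>A\<close>; with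
  \<open>\<parallel>F u\<parallel> \<le> \<parallel>F\<parallel>\<^sub>F \<parallel>u\<parallel>\<close> (Cauchy-Schwarz), applied to an eigenvector \<open>u\<close> of the Gram matrix of
  \<open>A F\<close>, it gives the claim. No spectral theorem is needed for the first bound: if it failed at
  \<open>v\<close>, choose \<open>c\<close> strictly between \<open>\<sigma>\<^sup>2\<close> and \<open>\<parallel>A v\<parallel>\<^sup>2 / \<parallel>v\<parallel>\<^sup>2\<close> and let \<open>H\<close> be the Gram matrix of
  \<open>A\<close> divided by \<open>c\<close>. Its spectral radius is below 1, so its powers are bounded. But
  \<open>a\<^sub>k = \<langle>H\<^sup>k v, v\<rangle>\<close> is a convex sequence, since \<open>a\<^sub>k - 2 a\<^sub>k\<^sub>+\<^sub>1 + a\<^sub>k\<^sub>+\<^sub>2 = \<langle>H\<^sup>k w, w\<rangle> \<ge> 0\<close> for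
  \<open>w = H v - v\<close>, and \<open>a\<^sub>0 < a\<^sub>1\<close>, so it is unbounded.
\<close>

section \<open>Squared Euclidean norms and matrices acting on vectors\<close>

definition norm_sq :: "complex vec \<Rightarrow> real" where
  "norm_sq v = (\<Sum>i<dim_vec v. (cmod (v $ i))\<^sup>2)"

lemma norm_sq_nonneg: "0 \<le> norm_sq v"
  by (simp add: norm_sq_def sum_nonneg)

lemma cscalar_prod_self: "v \<bullet>c v = complex_of_real (norm_sq v)"
  by (simp add: norm_sq_def scalar_prod_def lessThan_atLeast0 flip: complex_norm_square)

lemma norm_sq_pos:
  assumes "v \<in> carrier_vec n" "v \<noteq> 0\<^sub>v n"
  shows "0 < norm_sq v"
  using conjugate_square_greater_0_vec[OF assms(1)] assms(2)
  by (simp add: cscalar_prod_self less_complex_def)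

lemma norm_sq_minus:
  assumes "u \<in> carrier_vec n" "v \<in> carrier_vec n"
  shows "norm_sq (u - v) = norm_sq u - 2 * Re (u \<bullet>c v) + norm_sq v"
proof -
  have "(cmod (a - b))\<^sup>2 = (cmod a)\<^sup>2 - 2 * Re (a * cnj b) + (cmod b)\<^sup>2" for a b
    unfolding cmod_power2 by (simp add: power2_eq_square algebra_simps)
  then show ?thesis
    using assms by (simp add: norm_sq_def scalar_prod_def lessThan_atLeast0 sum.distrib
        sum_subtractf sum_distrib_left)
qed

lemma smult_mat_mult_vec:
  assumes "A \<in> carrier_mat m n" "v \<in> carrier_vec n"
  shows "k \<cdot>\<^sub>m A *\<^sub>v v = (k::'a::comm_semiring_0) \<cdot>\<^sub>v (A *\<^sub>v v)"
  using assms by (intro eq_vecI) (auto simp: scalar_prod_def sum_distrib_left mult_ac)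

text \<open>Matrix powers are defined with the new factor on the right; iterating a matrix on a
  vector needs it on the left.\<close>

lemma pow_mat_Suc_mult_vec:
  assumes "A \<in> carrier_mat n n" "v \<in> carrier_vec n"
  shows "A ^\<^sub>m Suc k *\<^sub>v v = (A :: 'a::semiring_1 mat) *\<^sub>v (A ^\<^sub>m k *\<^sub>v v)"
  using assms(2)
proof (induction k arbitrary: v)
  case 0
  then show ?case
    using assms(1) by simp
next
  case (Suc k)
  have split: "A ^\<^sub>m Suc j *\<^sub>v v = A ^\<^sub>m j *\<^sub>v (A *\<^sub>v v)" for j
    using assoc_mult_mat_vec[OF pow_carrier_mat[OF assms(1)] assms(1) Suc.prems] by simp
  show ?case
    using Suc.IH[of "A *\<^sub>v v"] mult_mat_vec_carrier[OF assms(1) Suc.prems]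
    unfolding split by blast
qed

section \<open>Adjoints and Gram matrices\<close>

lemma mat_adjoint_carrier:
  assumes "A \<in> carrier_mat m n"
  shows "mat_adjoint A \<in> carrier_mat n m"
  using assms by (intro carrier_matI) auto

lemma cscalar_prod_mat_adjoint:
  fixes A :: "complex mat"
  assumes A: "A \<in> carrier_mat m n" and w: "w \<in> carrier_vec m" and v: "v \<in> carrier_vec n"
  shows "(mat_adjoint A *\<^sub>v w) \<bullet>c v = w \<bullet>c (A *\<^sub>v v)"
proof -
  have "(mat_adjoint A *\<^sub>v w) \<bullet>c v
      = (\<Sum>i<n. (\<Sum>j<m. cnj (A $$ (j, i)) * w $ j) * cnj (v $ i))"
    using assms by (simp add: scalar_prod_def lessThan_atLeast0)
  also have "\<dots> = (\<Sum>j<m. w $ j * cnj (\<Sum>i<n. A $$ (j, i) * v $ i))"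
    unfolding sum_distrib_right sum_distrib_left cnj_sum
    by (subst sum.swap) (simp add: mult_ac)
  also have "\<dots> = w \<bullet>c (A *\<^sub>v v)"
    using assms by (simp add: scalar_prod_def lessThan_atLeast0)
  finally show ?thesis .
qed

lemma cscalar_prod_gram:
  fixes A :: "complex mat"
  assumes A: "A \<in> carrier_mat m n" and u: "u \<in> carrier_vec n" and v: "v \<in> carrier_vec n"
  shows "(mat_adjoint A * A *\<^sub>v u) \<bullet>c v = (A *\<^sub>v u) \<bullet>c (A *\<^sub>v v)"
  using cscalar_prod_mat_adjoint[OF A mult_mat_vec_carrier[OF A u] v]
  by (simp add: assoc_mult_mat_vec[OF mat_adjoint_carrier[OF A] A u])

lemma gram_eigenvector_norm_sq:
  assumes A: "A \<in> carrier_mat m n" and u: "u \<in> carrier_vec n"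
    and Gu: "mat_adjoint A * A *\<^sub>v u = k \<cdot>\<^sub>v u"
  shows "k * complex_of_real (norm_sq u) = complex_of_real (norm_sq (A *\<^sub>v u))"
  using cscalar_prod_gram[OF A u u] u by (simp add: Gu cscalar_prod_self)

text \<open>Pairing the eigenvector equation with the eigenvector \<open>u\<close> gives
  \<open>k = norm_sq (A *\<^sub>v u) / norm_sq u\<close>, a nonnegative real, whose square root is
  the required singular value.\<close>

lemma eigenvalue_gramE:
  assumes "eigenvalue (mat_adjoint A * A) k"
  obtains s where "s \<in> singular_values A" "k = complex_of_real (s\<^sup>2)"
proof -
  have A: "A \<in> carrier_mat (dim_row A) (dim_col A)"
    by simp
  obtain u where u: "u \<in> carrier_vec (dim_col A)" "u \<noteq> 0\<^sub>v (dim_col A)"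
    and Gu: "mat_adjoint A * A *\<^sub>v u = k \<cdot>\<^sub>v u"
    using assms by (auto simp: eigenvalue_def eigenvector_def)
  define r where "r = norm_sq (A *\<^sub>v u) / norm_sq u"
  have "0 \<le> r"
    by (simp add: r_def norm_sq_nonneg)
  have "k = complex_of_real r"
    using gram_eigenvector_norm_sq[OF A u(1) Gu] norm_sq_pos[OF u]
    by (simp add: r_def field_simps)
  then show thesis
    using that[of "sqrt r"] assms \<open>0 \<le> r\<close>
    by (simp add: singular_values_def flip: of_real_power)
qed

section \<open>Frobenius norm estimates\<close>

lemma frobenius_norm_sq:
  "(frobenius_norm A)\<^sup>2 = (\<Sum>i<dim_row A. \<Sum>j<dim_col A. (cmod (A $$ (i, j)))\<^sup>2)"
  unfolding frobenius_norm_def by (intro real_sqrt_pow2 sum_nonneg) simp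

lemma norm_sq_mult_mat_vec_le_frobenius:
  assumes A: "A \<in> carrier_mat m n" and v: "v \<in> carrier_vec n"
  shows "norm_sq (A *\<^sub>v v) \<le> (frobenius_norm A)\<^sup>2 * norm_sq v"
proof -
  have "(cmod (\<Sum>j<n. A $$ (i, j) * v $ j))\<^sup>2 \<le> (\<Sum>j<n. (cmod (A $$ (i, j)))\<^sup>2) * norm_sq v" for i
  proof -
    have "cmod (\<Sum>j<n. A $$ (i, j) * v $ j) \<le> (\<Sum>j<n. cmod (A $$ (i, j)) * cmod (v $ j))"
      by (rule order_trans[OF norm_sum]) (simp add: norm_mult)
    then have "(cmod (\<Sum>j<n. A $$ (i, j) * v $ j))\<^sup>2
        \<le> (\<Sum>j<n. cmod (A $$ (i, j)) * cmod (v $ j))\<^sup>2"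
      by (intro power_mono) auto
    also have "\<dots> \<le> (\<Sum>j<n. (cmod (A $$ (i, j)))\<^sup>2) * (\<Sum>j<n. (cmod (v $ j))\<^sup>2)"
      by (rule Cauchy_Schwarz_ineq_sum)
    finally show ?thesis
      using v by (simp add: norm_sq_def)
  qed
  then have "(\<Sum>i<m. (cmod (\<Sum>j<n. A $$ (i, j) * v $ j))\<^sup>2)
      \<le> (\<Sum>i<m. (\<Sum>j<n. (cmod (A $$ (i, j)))\<^sup>2) * norm_sq v)"
    by (intro sum_mono) auto
  moreover have "norm_sq (A *\<^sub>v v) = (\<Sum>i<m. (cmod (\<Sum>j<n. A $$ (i, j) * v $ j))\<^sup>2)"
    using A v by (simp add: norm_sq_def scalar_prod_def lessThan_atLeast0)
  ultimately show ?thesis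
    using A by (simp add: frobenius_norm_sq sum_distrib_right)
qed

text \<open>Turns an entrywise bound on the powers of a matrix into a bound on their action on
  vectors. The estimate is crude, but only its independence of the exponent matters.\<close>

lemma frobenius_norm_sq_le_norm_bound:
  assumes A: "A \<in> carrier_mat m n" and b: "norm_bound A b"
  shows "(frobenius_norm A)\<^sup>2 \<le> real m * real n * b\<^sup>2"
proof -
  have "(cmod (A $$ (i, j)))\<^sup>2 \<le> b\<^sup>2" if "i < m" "j < n" for i j
    using that A b by (intro power_mono) (auto simp: norm_bound_def)
  then have "(frobenius_norm A)\<^sup>2 \<le> (\<Sum>i<m. \<Sum>j<n. b\<^sup>2)"
    unfolding frobenius_norm_sq carrier_matD[OF A] by (intro sum_mono) auto
  then show ?thesis
    by simp
qed

section \<open>The largest singular value bounds the growth of vectors\<close>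

lemma sigma_max_mem:
  assumes "0 < dim_col A"
  shows "sigma_max A \<in> singular_values A"
  unfolding sigma_max_def
  by (rule Max_in[OF finite_singular_values singular_values_nonempty[OF assms]])

lemma singular_value_le_sigma_max: "s \<in> singular_values A \<Longrightarrow> s \<le> sigma_max A"
  unfolding sigma_max_def by (rule Max_ge[OF finite_singular_values])

text \<open>If \<open>k\<close> is an eigenvalue of the scaled matrix, then \<open>c * k\<close> is
  one of the Gram matrix, hence the square of a singular value and at most
  \<open>(sigma_max A)\<^sup>2 < c\<close>.\<close>

lemma spectral_radius_scaled_gram_less_1:
  assumes A: "A \<in> carrier_mat m n" and n: "0 < n" and c: "(sigma_max A)\<^sup>2 < c"
  shows "spectral_radius (complex_of_real (1 / c) \<cdot>\<^sub>m (mat_adjoint A * A)) < 1"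
    (is "spectral_radius ?H < 1")
proof -
  have c0: "0 < c"
    using c zero_le_power2[of "sigma_max A"] by linarith
  have G: "mat_adjoint A * A \<in> carrier_mat n n"
    using gram_carrier[of A] A by auto
  then have H: "?H \<in> carrier_mat n n"
    by simp
  obtain k where k: "eigenvalue ?H k" and sr: "spectral_radius ?H = cmod k"
    using spectral_radius_mem_max(1)[OF H n] by (auto simp: spectrum_def)
  obtain u where u: "u \<in> carrier_vec n" "u \<noteq> 0\<^sub>v n" and Hu: "?H *\<^sub>v u = k \<cdot>\<^sub>v u"
    using k H by (auto simp: eigenvalue_def eigenvector_def)
  have "mat_adjoint A * A *\<^sub>v u = complex_of_real c \<cdot>\<^sub>v (?H *\<^sub>v u)"
    using G u c0 by (simp add: smult_mat_mult_vec[OF G u(1)] smult_smult_assoc)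
  also have "\<dots> = (complex_of_real c * k) \<cdot>\<^sub>v u"
    unfolding Hu smult_smult_assoc ..
  finally have "eigenvalue (mat_adjoint A * A) (complex_of_real c * k)"
    using u A by (auto simp: eigenvalue_def eigenvector_def)
  then obtain s where s: "s \<in> singular_values A" "complex_of_real c * k = complex_of_real (s\<^sup>2)"
    by (rule eigenvalue_gramE)
  then have "s\<^sup>2 \<le> (sigma_max A)\<^sup>2"
    using singular_value_le_sigma_max by (intro power_mono) (auto simp: singular_values_def)
  moreover have "c * cmod k = s\<^sup>2"
    using arg_cong[OF s(2), of cmod] c0 by (simp add: norm_mult norm_power)
  ultimately show ?thesis
    using c c0 sr by (simp add: mult_less_cancel_left_pos[of c _ 1, symmetric])
qed

text \<open>
  With \<open>a\<^sub>k = \<langle>H\<^sup>k v, v\<rangle>\<close> and \<open>x = H\<^sup>k v\<close>, the terms \<open>a\<^sub>2\<^sub>k\<close>, \<open>a\<^sub>2\<^sub>k\<^sub>+\<^sub>1\<close>, \<open>a\<^sub>2\<^sub>k\<^sub>+\<^sub>2\<close> and \<open>a\<^sub>2\<^sub>k\<^sub>+\<^sub>3\<close> are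
  \<open>\<parallel>x\<parallel>\<^sup>2\<close>, \<open>\<parallel>A x\<parallel>\<^sup>2 / c\<close>, \<open>\<parallel>H x\<parallel>\<^sup>2\<close> and \<open>\<parallel>A H x\<parallel>\<^sup>2 / c\<close>.
\<close>

lemma scaled_gram_step:
  assumes A: "A \<in> carrier_mat m n" and x: "x \<in> carrier_vec n" and c: "0 < c"
  defines "y \<equiv> complex_of_real (1 / c) \<cdot>\<^sub>m (mat_adjoint A * A) *\<^sub>v x"
  assumes d: "d \<le> norm_sq (A *\<^sub>v x) / c - norm_sq x"
  shows "norm_sq x + 2 * d \<le> norm_sq y" "d \<le> norm_sq (A *\<^sub>v y) / c - norm_sq y"
proof -
  have G: "mat_adjoint A * A \<in> carrier_mat n n"
    using gram_carrier[of A] A by auto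
  have y: "y \<in> carrier_vec n"
    unfolding y_def by (intro mult_mat_vec_carrier[of _ n n] smult_carrier_mat G x)
  have yz: "y \<bullet>c z = complex_of_real (1 / c) * ((A *\<^sub>v x) \<bullet>c (A *\<^sub>v z))"
    if z: "z \<in> carrier_vec n" for z
    unfolding y_def smult_mat_mult_vec[OF G x] cscalar_prod_gram[OF A x z, symmetric]
    using z by (intro smult_scalar_prod_distrib[OF mult_mat_vec_carrier[OF G x]]) simp
  have "Re (y \<bullet>c x) = norm_sq (A *\<^sub>v x) / c"
    by (simp add: yz[OF x] cscalar_prod_self)
  \<comment> \<open>Expanding \<open>norm_sq (y - x)\<close> gives the second difference that starts
    at an even index.\<close>
  then have 1: "0 \<le> norm_sq y - 2 * (norm_sq (A *\<^sub>v x) / c) + norm_sq x"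
    using norm_sq_minus[OF y x] norm_sq_nonneg[of "y - x"] by simp
  then show "norm_sq x + 2 * d \<le> norm_sq y"
    using d by linarith
  have "complex_of_real (norm_sq y) = complex_of_real (1 / c) * ((A *\<^sub>v x) \<bullet>c (A *\<^sub>v y))"
    using yz[OF y] by (simp add: cscalar_prod_self)
  then have "(A *\<^sub>v x) \<bullet>c (A *\<^sub>v y) = complex_of_real (c * norm_sq y)"
    using c by (simp add: field_simps)
  \<comment> \<open>Expanding \<open>norm_sq (A *\<^sub>v x - A *\<^sub>v y)\<close> gives, up to
    the factor \<open>c\<close>, the second difference that starts at an odd index.\<close>
  then have "0 \<le> norm_sq (A *\<^sub>v x) - 2 * (c * norm_sq y) + norm_sq (A *\<^sub>v y)"
    using norm_sq_minus[of "A *\<^sub>v x" m "A *\<^sub>v y"] norm_sq_nonneg[of "A *\<^sub>v x - A *\<^sub>v y"] A x y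
    by simp
  then have "0 \<le> (norm_sq (A *\<^sub>v x) - 2 * (c * norm_sq y) + norm_sq (A *\<^sub>v y)) / c"
    using c by simp
  also have "\<dots> = norm_sq (A *\<^sub>v x) / c - 2 * norm_sq y + norm_sq (A *\<^sub>v y) / c"
    using c by (simp add: field_simps)
  finally show "d \<le> norm_sq (A *\<^sub>v y) / c - norm_sq y"
    using d 1 by linarith
qed

lemma norm_sq_mult_mat_vec_le_sigma_max:
  assumes A: "A \<in> carrier_mat m n" and v: "v \<in> carrier_vec n" and n: "0 < n"
  shows "norm_sq (A *\<^sub>v v) \<le> (sigma_max A)\<^sup>2 * norm_sq v"
proof (cases "v = 0\<^sub>v n")
  case True
  then show ?thesis
    using A by (simp add: norm_sq_def)
next
  case False
  then have v0: "0 < norm_sq v"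
    using v by (rule norm_sq_pos[rotated])
  show ?thesis
  proof (rule ccontr)
    assume "\<not> ?thesis"
    then have "(sigma_max A)\<^sup>2 < norm_sq (A *\<^sub>v v) / norm_sq v"
      using v0 by (simp add: field_simps)
    then obtain c where c: "(sigma_max A)\<^sup>2 < c" and cv: "c < norm_sq (A *\<^sub>v v) / norm_sq v"
      using dense by blast
    have c0: "0 < c"
      using c zero_le_power2[of "sigma_max A"] by linarith
    define d where "d = norm_sq (A *\<^sub>v v) / c - norm_sq v"
    have d0: "0 < d"
      using cv c0 v0 by (simp add: d_def field_simps)
    define H where "H = complex_of_real (1 / c) \<cdot>\<^sub>m (mat_adjoint A * A)"
    have H: "H \<in> carrier_mat n n"
      using gram_carrier[of A] A by (auto simp: H_def)
    obtain b where b: "norm_bound (H ^\<^sub>m k) b" for k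
      using spectral_radius_jnf_norm_bound_less_1_upper_triangular[OF H]
        spectral_radius_scaled_gram_less_1[OF A n c] by (auto simp: H_def)
    have iter: "H ^\<^sub>m k *\<^sub>v v \<in> carrier_vec n" for k
      using mult_mat_vec_carrier[OF pow_carrier_mat[OF H] v] .
    \<comment> \<open>By convexity no increment falls below the first one, \<open>d\<close>. Each
      power of \<open>H\<close> advances the sequence by two terms, whence the factor 2.\<close>
    have grow: "norm_sq v + 2 * real k * d \<le> norm_sq (H ^\<^sub>m k *\<^sub>v v) \<and>
        d \<le> norm_sq (A *\<^sub>v (H ^\<^sub>m k *\<^sub>v v)) / c - norm_sq (H ^\<^sub>m k *\<^sub>v v)" for k
    proof (induction k)
      case 0
      then show ?case
        using v H by (simp add: d_def)
    next
      case (Suc k)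
      then show ?case
        using scaled_gram_step[OF A iter[of k] c0, of d] unfolding pow_mat_Suc_mult_vec[OF H v] H_def[symmetric]
        by (auto simp: algebra_simps simp del: pow_mat.simps)
    qed
    define B where "B = real n * real n * b\<^sup>2 * norm_sq v"
    have bounded: "norm_sq (H ^\<^sub>m k *\<^sub>v v) \<le> B" for k
      using norm_sq_mult_mat_vec_le_frobenius[OF pow_carrier_mat[OF H] v, of k]
        mult_right_mono[OF frobenius_norm_sq_le_norm_bound[OF pow_carrier_mat[OF H] b, of k]
          norm_sq_nonneg[of v]]
      unfolding B_def by linarith
    obtain k where "B < real k * d"
      using reals_Archimedean3[OF d0] by blast
    then show False
      using grow[of k] bounded[of k] v0 norm_sq_nonneg[of "H ^\<^sub>m k *\<^sub>v v"] by (simp; linarith)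
  qed
qed

section \<open>Products and the power constraint\<close>

lemma sigma_max_mult_le:
  assumes A: "A \<in> carrier_mat m n" and F: "F \<in> carrier_mat n p" and n: "0 < n" and p: "0 < p"
  shows "(sigma_max (A * F))\<^sup>2 \<le> (sigma_max A)\<^sup>2 * (frobenius_norm F)\<^sup>2"
proof -
  have AF: "A * F \<in> carrier_mat m p"
    using A F by simp
  \<comment> \<open>Since \<open>0 < p\<close>, the set of singular values is nonempty and its
    maximum is attained.\<close>
  have "eigenvalue (mat_adjoint (A * F) * (A * F)) (complex_of_real ((sigma_max (A * F))\<^sup>2))"
    using sigma_max_mem[of "A * F"] F p by (simp add: singular_values_def)
  then obtain u where u: "u \<in> carrier_vec p" "u \<noteq> 0\<^sub>v p"
    and eig: "mat_adjoint (A * F) * (A * F) *\<^sub>v u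
      = complex_of_real ((sigma_max (A * F))\<^sup>2) \<cdot>\<^sub>v u"
    using F by (auto simp: eigenvalue_def eigenvector_def)
  have "(sigma_max (A * F))\<^sup>2 * norm_sq u = norm_sq (A * F *\<^sub>v u)"
    using gram_eigenvector_norm_sq[OF AF u(1) eig] unfolding of_real_mult[symmetric] of_real_eq_iff .
  also have "\<dots> = norm_sq (A *\<^sub>v (F *\<^sub>v u))"
    by (simp add: assoc_mult_mat_vec[OF A F u(1)])
  also have "\<dots> \<le> (sigma_max A)\<^sup>2 * norm_sq (F *\<^sub>v u)"
    by (rule norm_sq_mult_mat_vec_le_sigma_max[OF A mult_mat_vec_carrier[OF F u(1)] n])
  also have "\<dots> \<le> (sigma_max A)\<^sup>2 * ((frobenius_norm F)\<^sup>2 * norm_sq u)"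
    by (intro mult_left_mono norm_sq_mult_mat_vec_le_frobenius[OF F u(1)]) simp
  finally show ?thesis
    using norm_sq_pos[OF u] by (simp flip: mult.assoc)
qed

theorem theorem3:
  fixes N\<^sub>t N\<^sub>r L\<^sub>t L\<^sub>r N\<^sub>s :: nat
    and H\<^sub>i\<^sub>i F\<^sub>R\<^sub>F W\<^sub>R\<^sub>F :: "complex mat"
    and \<eta>\<^sub>A\<^sub>D\<^sub>C :: real
  assumes "0 < N\<^sub>t" "0 < N\<^sub>r" "0 < L\<^sub>t" "0 < L\<^sub>r" and "1 \<le> N\<^sub>s"
    and "H\<^sub>i\<^sub>i \<in> carrier_mat N\<^sub>r N\<^sub>t"
    and "F\<^sub>R\<^sub>F \<in> carrier_mat N\<^sub>t L\<^sub>t"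
    and "W\<^sub>R\<^sub>F \<in> carrier_mat N\<^sub>r L\<^sub>r"
    and "0 \<le> \<eta>\<^sub>A\<^sub>D\<^sub>C"
    and "\<eta>\<^sub>A\<^sub>D\<^sub>C \<ge> 1 / real N\<^sub>s * (sigma_max (mat_adjoint W\<^sub>R\<^sub>F * H\<^sub>i\<^sub>i * F\<^sub>R\<^sub>F))\<^sup>2"
  shows "\<forall>F\<^sub>B\<^sub>B \<in> carrier_mat L\<^sub>t N\<^sub>s. (frobenius_norm F\<^sub>B\<^sub>B)\<^sup>2 \<le> 1 \<longrightarrow>
    1 / real N\<^sub>s * (sigma_max (mat_adjoint W\<^sub>R\<^sub>F * H\<^sub>i\<^sub>i * F\<^sub>R\<^sub>F * F\<^sub>B\<^sub>B))\<^sup>2 \<le> \<eta>\<^sub>A\<^sub>D\<^sub>C"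
proof (intro ballI impI)
  fix F assume F: "F \<in> carrier_mat L\<^sub>t N\<^sub>s" and le: "(frobenius_norm F)\<^sup>2 \<le> 1"
  let ?A = "mat_adjoint W\<^sub>R\<^sub>F * H\<^sub>i\<^sub>i * F\<^sub>R\<^sub>F"
  have A: "?A \<in> carrier_mat L\<^sub>r L\<^sub>t"
    using assms by (intro mult_carrier_mat mat_adjoint_carrier)
  have "(sigma_max (?A * F))\<^sup>2 \<le> (sigma_max ?A)\<^sup>2 * (frobenius_norm F)\<^sup>2"
    using assms by (intro sigma_max_mult_le[OF A F]) auto
  also have "\<dots> \<le> (sigma_max ?A)\<^sup>2"
    using mult_left_mono[OF le, of "(sigma_max ?A)\<^sup>2"] by simp
  finally have "1 / real N\<^sub>s * (sigma_max (?A * F))\<^sup>2 \<le> 1 / real N\<^sub>s * (sigma_max ?A)\<^sup>2"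
    by (intro mult_left_mono) auto
  then show "1 / real N\<^sub>s * (sigma_max (?A * F))\<^sup>2 \<le> \<eta>\<^sub>A\<^sub>D\<^sub>C"
    using assms(10) by linarith
qed

end
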